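(* Let $\Lambda$ be a finite group with $\#\Lambda\ge 2$, and let $G=\left(\bigoplus_{\mathbb{Z}}\Lambda\right)\rtimes\mathbb{Z}$ be the associated lamplighter group, i.e. the (restricted) wreath product of $\Lambda$ with $\mathbb{Z}$. Then $G$ admits a weakly aperiodic subshift of finite type: there exist a finite set $A$ and a subshift of finite type $X\subseteq A^G$ such that $X$ is nonempty and no $\sigma\in X$ is fixed by a finite index subgroup of $G$.
   Context: Lamplighter group: for a finite group $\Lambda$, $\bigoplus_{\mathbb{Z}}\Lambda$ is the direct sum of copies $\Lambda_i$ ($i\in\mathbb{Z}$) of $\Lambda$. For $\lambda\in\Lambda$, $[\lambda]_i$ is the element whose $i$-th coordinate is $\lambda$ and whose other coordinates are the identity. The generator $t$ of $\mathbb{Z}$ acts by $t[\lambda]_i t^{-1}=[\lambda]_{i+1}$, and $G=\left(\bigoplus_{\mathbb{Z}}\Lambda\right)\rtimes\mathbb{Z}$ is the corresponding semidirect product. Subshifts: for a finite set $A$ and a group $G$, $A^G$ is the set of all functions $G\to A$, with the product topology ($A$ discrete) and the right $G$-action $(\sigma\cdot g)(h):=\sigma(gh)$. A pattern is a function $p:F\to A$ with $F\subseteq G$ finite. Given finitely many patterns $p_1:F_1\to A,\ldots,p_n:F_n\to A$, let $K\subseteq A^G$ be the set of all $\sigma\in A^G$ such that $\sigma|_{F_i}\neq p_i$ for every $i=1,\ldots,n$. The set $X=\bigcap_{g\in G}K\cdot g$ is called a subshift of finite type (SFT); every SFT arises in this way. A configuration $\sigma\in A^G$ is fixed by a subgroup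 $\Gamma\subseteq G$ if $\sigma\cdot\gamma=\sigma$ for all $\gamma\in\Gamma$. An SFT $X\subseteq A^G$ is weakly aperiodic if it is nonempty and contains no configuration fixed by a finite index subgroup of $G$. *)

theory Defs
  imports "HOL-Algebra.Product_Groups"
begin

section \<open>The lamplighter group\<close>

definition semidirect_product ::
  "('n, 'a) monoid_scheme \<Rightarrow> ('h, 'b) monoid_scheme \<Rightarrow> ('h \<Rightarrow> 'n \<Rightarrow> 'n) \<Rightarrow> ('n \<times> 'h) monoid"
  where "semidirect_product N H \<phi> =
    \<lparr>carrier = carrier N \<times> carrier H,
     monoid.mult = (\<lambda>(x, g) (y, h). (x \<otimes>\<^bsub>N\<^esub> \<phi> g y, g \<otimes>\<^bsub>H\<^esub> h)),
     one = (\<one>\<^bsub>N\<^esub>, \<one>\<^bsub>H\<^esub>)\<rparr>"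

text \<open>The integer \<open>m\<close> acts by moving the \<open>i\<close>-th coordinate to position \<open>i + m\<close>;
  \<open>lamplighter_conj\<close> below is the defining relation of this action.\<close>

definition coord_shift :: "int \<Rightarrow> (int \<Rightarrow> 'a) \<Rightarrow> (int \<Rightarrow> 'a)"
  where "coord_shift m x = (\<lambda>i. x (i - m))"

definition lamplighter :: "('a, 'b) monoid_scheme \<Rightarrow> ((int \<Rightarrow> 'a) \<times> int) monoid"
  where "lamplighter L = semidirect_product (sum_group UNIV (\<lambda>_. L)) integer_group coord_shift"

definition lamp :: "('a, 'b) monoid_scheme \<Rightarrow> 'a \<Rightarrow> int \<Rightarrow> (int \<Rightarrow> 'a) \<times> int"
  where "lamp L l i = ((\<lambda>j. if j = i then l else \<one>\<^bsub>L\<^esub>), 0)"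

definition lamplighter_gen :: "('a, 'b) monoid_scheme \<Rightarrow> (int \<Rightarrow> 'a) \<times> int"
  where "lamplighter_gen L = ((\<lambda>_. \<one>\<^bsub>L\<^esub>), 1)"

lemma carrier_lamplighter:
  assumes "group L"
  shows "carrier (lamplighter L) =
    {x. (\<forall>i. x i \<in> carrier L) \<and> finite {i. x i \<noteq> \<one>\<^bsub>L\<^esub>}} \<times> UNIV"
  using assms by (auto simp: lamplighter_def semidirect_product_def carrier_sum_group)

lemma mult_lamplighter:
  "(x, m) \<otimes>\<^bsub>lamplighter L\<^esub> (y, n) = ((\<lambda>i. x i \<otimes>\<^bsub>L\<^esub> y (i - m)), m + n)"
  by (simp add: lamplighter_def semidirect_product_def coord_shift_def restrict_def)

lemma one_lamplighter: "\<one>\<^bsub>lamplighter L\<^esub> = ((\<lambda>_. \<one>\<^bsub>L\<^esub>), 0)"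
  by (simp add: lamplighter_def semidirect_product_def restrict_def)

lemma finite_shift_support:
  assumes "finite {i::int. P i}" shows "finite {i. P (i + m)}"
proof -
  have "{i. P (i + m)} = (\<lambda>i. i - m) ` {i. P i}"
    by (auto simp: image_iff intro!: exI[of _ "_ + m"])
  then show ?thesis using assms by simp
qed

lemma group_lamplighter:
  assumes "group L" shows "group (lamplighter L)"
proof -
  interpret L: group L by fact
  show ?thesis
  proof (rule groupI)
    fix u v assume "u \<in> carrier (lamplighter L)" "v \<in> carrier (lamplighter L)"
    then obtain x m y n where uv: "u = (x, m)" "v = (y, n)"
      and x: "\<forall>i. x i \<in> carrier L" "finite {i. x i \<noteq> \<one>\<^bsub>L\<^esub>}"
      and y: "\<forall>i. y i \<in> carrier L" "finite {i. y i \<noteq> \<one>\<^bsub>L\<^esub>}"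
      by (auto simp: carrier_lamplighter[OF assms])
    have "finite {i. y (i - m) \<noteq> \<one>\<^bsub>L\<^esub>}"
      using finite_shift_support[OF y(2), of "- m"] by simp
    then have "finite {i. x i \<otimes>\<^bsub>L\<^esub> y (i - m) \<noteq> \<one>\<^bsub>L\<^esub>}"
      by (rule rev_finite_subset[OF finite_UnI[OF x(2)]]) auto
    then show "u \<otimes>\<^bsub>lamplighter L\<^esub> v \<in> carrier (lamplighter L)"
      using x y by (simp add: uv mult_lamplighter carrier_lamplighter[OF assms])
  next
    fix u assume "u \<in> carrier (lamplighter L)"
    then obtain x m where u: "u = (x, m)"
      and x: "\<forall>i. x i \<in> carrier L" "finite {i. x i \<noteq> \<one>\<^bsub>L\<^esub>}"
      by (auto simp: carrier_lamplighter[OF assms])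
    let ?v = "((\<lambda>i. inv\<^bsub>L\<^esub> x (i + m)), - m)"
    have "finite {i. inv\<^bsub>L\<^esub> x (i + m) \<noteq> \<one>\<^bsub>L\<^esub>}"
      using finite_shift_support[OF x(2), of m] by (rule rev_finite_subset) auto
    then have "?v \<in> carrier (lamplighter L)"
      using x by (simp add: carrier_lamplighter[OF assms])
    moreover have "?v \<otimes>\<^bsub>lamplighter L\<^esub> u = \<one>\<^bsub>lamplighter L\<^esub>"
      using x by (simp add: u mult_lamplighter one_lamplighter)
    ultimately show "\<exists>v\<in>carrier (lamplighter L). v \<otimes>\<^bsub>lamplighter L\<^esub> u = \<one>\<^bsub>lamplighter L\<^esub>"
      by blast
  qed (auto simp: carrier_lamplighter[OF assms] mult_lamplighter one_lamplighter
        L.m_assoc algebra_simps)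
qed

lemma lamplighter_conj:
  assumes "group L" "l \<in> carrier L"
  shows "lamplighter_gen L \<otimes>\<^bsub>lamplighter L\<^esub> lamp L l i
           \<otimes>\<^bsub>lamplighter L\<^esub> inv\<^bsub>lamplighter L\<^esub> (lamplighter_gen L)
         = lamp L l (i + 1)"
proof -
  interpret L: group L by fact
  interpret G: group "lamplighter L" using assms(1) by (rule group_lamplighter)
  have c: "lamplighter_gen L \<in> carrier (lamplighter L)" "lamp L l j \<in> carrier (lamplighter L)" for j
    using assms
    by (auto simp: carrier_lamplighter lamplighter_gen_def lamp_def)
  have "lamplighter_gen L \<otimes>\<^bsub>lamplighter L\<^esub> lamp L l i
      = lamp L l (i + 1) \<otimes>\<^bsub>lamplighter L\<^esub> lamplighter_gen L"
    using assms by (auto simp: mult_lamplighter lamplighter_gen_def lamp_def)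
  then show ?thesis
    using c by (simp add: G.inv_solve_right G.m_assoc)
qed

section \<open>Subshifts of finite type\<close>

text \<open>Configurations are the extensional functions on the carrier, so that equality of
  configurations is equality on the carrier.\<close>

definition configs :: "('g, 'b) monoid_scheme \<Rightarrow> 'c set \<Rightarrow> ('g \<Rightarrow> 'c) set"
  where "configs G A = carrier G \<rightarrow>\<^sub>E A"

definition config_act :: "('g, 'b) monoid_scheme \<Rightarrow> ('g \<Rightarrow> 'c) \<Rightarrow> 'g \<Rightarrow> ('g \<Rightarrow> 'c)"
  where "config_act G \<sigma> g = (\<lambda>h\<in>carrier G. \<sigma> (g \<otimes>\<^bsub>G\<^esub> h))"

text \<open>A pattern \<open>p : F \<rightarrow> A\<close> is encoded as the pair \<open>(F, p)\<close>.\<close>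

definition patterns :: "('g, 'b) monoid_scheme \<Rightarrow> 'c set \<Rightarrow> ('g set \<times> ('g \<Rightarrow> 'c)) set"
  where "patterns G A = {(F, p). F \<subseteq> carrier G \<and> finite F \<and> p \<in> F \<rightarrow>\<^sub>E A}"

definition avoiding ::
  "('g, 'b) monoid_scheme \<Rightarrow> 'c set \<Rightarrow> ('g set \<times> ('g \<Rightarrow> 'c)) set \<Rightarrow> ('g \<Rightarrow> 'c) set"
  where "avoiding G A P = {\<sigma> \<in> configs G A. \<forall>(F, p)\<in>P. restrict \<sigma> F \<noteq> p}"

definition SFT :: "('g, 'b) monoid_scheme \<Rightarrow> 'c set \<Rightarrow> ('g \<Rightarrow> 'c) set \<Rightarrow> bool"
  where "SFT G A S \<longleftrightarrow> (\<exists>P. finite P \<and> P \<subseteq> patterns G A \<and>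
    S = (\<Inter>g\<in>carrier G. (\<lambda>\<sigma>. config_act G \<sigma> g) ` avoiding G A P))"

definition fixed_by :: "('g, 'b) monoid_scheme \<Rightarrow> ('g \<Rightarrow> 'c) \<Rightarrow> 'g set \<Rightarrow> bool"
  where "fixed_by G \<sigma> \<Gamma> \<longleftrightarrow> (\<forall>\<gamma>\<in>\<Gamma>. config_act G \<sigma> \<gamma> = \<sigma>)"

definition finite_index_subgroup :: "'g set \<Rightarrow> ('g, 'b) monoid_scheme \<Rightarrow> bool"
  where "finite_index_subgroup \<Gamma> G \<longleftrightarrow> subgroup \<Gamma> G \<and> finite (rcosets\<^bsub>G\<^esub> \<Gamma>)"

definition weakly_aperiodic :: "('g, 'b) monoid_scheme \<Rightarrow> ('g \<Rightarrow> 'c) set \<Rightarrow> bool"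
  where "weakly_aperiodic G S \<longleftrightarrow>
    S \<noteq> {} \<and> \<not> (\<exists>\<sigma>\<in>S. \<exists>\<Gamma>. finite_index_subgroup \<Gamma> G \<and> fixed_by G \<sigma> \<Gamma>)"

end

theory Submission
  imports Defs
begin

text \<open>
  The subshift uses three colours and a single local rule: around every \<open>g\<close>, the colours of the
  elements \<open>g [l]\<^sub>0\<close> are exactly the two colours different from that of \<open>g t\<close>.

  The rule lets the set of colours on \<open>g \<Lambda>\<^sub>0\<close> decide the colour of \<open>g t\<close>. Since \<open>t\<close> moves lamp
  \<open>- i - 1\<close> to lamp \<open>- i\<close>, being unaffected by changes of one lamp propagates downwards:
  the colour of \<open>h\<close> does not see lamp \<open>- 1\<close>, because \<open>g [l]\<^sub>0\<close> and \<open>g\<close> span the same coset of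
  \<open>\<Lambda>\<^sub>0\<close>, and then it sees none of the lamps \<open>- 2, - 3, \<dots>\<close>
  (lemma \<open>coloring_lamp_invariant\<close>). In the Diestel--Leader picture of the group as a horocyclic
  product of two trees, the colouring is pulled back from one of the trees.

  Now suppose that the colouring is constant on the right cosets of a subgroup of finite index. By
  the pigeonhole principle some positive power \<open>t\<^sup>m\<close> fixes, by right multiplication, the cosets of
  all the \<open>[l]\<^sub>0\<close>. Hence \<open>[l]\<^sub>0\<close> has the colour of \<open>[l]\<^sub>0 t\<^sup>m = t\<^sup>m [l]\<^sub>-\<^sub>m\<close>, which is the colour of
  \<open>t\<^sup>m\<close> whatever \<open>l\<close> is. This contradicts the rule, which asks for two colours among the \<open>[l]\<^sub>0\<close>.

  The subshift is not empty because the rule is compatible with the tree: the children \<open>g [l]\<^sub>0\<close>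
  of a parent \<open>g t\<close> coloured \<open>a\<close> can be coloured \<open>a + 1\<close> or \<open>a + 2\<close> modulo 3 according to
  whether their lamp at the current position is off or on (lemma \<open>coloring_height_lamp_count\<close>).
\<close>

section \<open>Local rules and finite index subgroups\<close>

text \<open>
  The forbidden patterns are all the patterns on the window \<open>F\<close> that violate \<open>Q\<close>. A configuration
  lies in the translate of \<open>avoiding G A P\<close> by \<open>g\<close> iff its translate by \<open>inv g\<close> avoids \<open>P\<close>, so
  intersecting over all translates imposes \<open>Q\<close> at every place.
\<close>

lemma SFT_local_rule:
  fixes G (structure)
  assumes "group G" "finite A" "finite F" "F \<subseteq> carrier G"
  shows "SFT G A {\<sigma> \<in> configs G A. \<forall>g\<in>carrier G. Q (\<lambda>h\<in>F. \<sigma> (g \<otimes> h))}" (is "SFT G A ?S")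
proof -
  interpret group G by fact
  define P where "P = {F} \<times> {p \<in> F \<rightarrow>\<^sub>E A. \<not> Q p}"
  have act_mem: "config_act G \<sigma> g \<in> configs G A" if "\<sigma> \<in> configs G A" "g \<in> carrier G" for \<sigma> g
    using that by (auto simp: config_act_def configs_def)
  have act_inv: "config_act G (config_act G \<sigma> g) g' = \<sigma>"
    if "\<sigma> \<in> configs G A" "g \<in> carrier G" "g' \<in> carrier G" "g \<otimes> g' = \<one>" for \<sigma> g g'
  proof
    fix h
    show "config_act G (config_act G \<sigma> g) g' h = \<sigma> h"
    proof (cases "h \<in> carrier G")
      case True
      then have "g \<otimes> (g' \<otimes> h) = h"
        using that by (simp flip: m_assoc)
      then show ?thesis using True that by (simp add: config_act_def)
    next
      case False
      then show ?thesis using that by (auto simp: config_act_def configs_def PiE_def extensional_def)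
    qed
  qed
  have avoid: "\<sigma> \<in> avoiding G A P \<longleftrightarrow> Q (restrict \<sigma> F)" if "\<sigma> \<in> configs G A" for \<sigma>
  proof -
    have *: "(\<forall>(F', p)\<in>{F} \<times> {p \<in> X. \<not> Q p}. f F' \<noteq> p) \<longleftrightarrow> Q (f F)"
      if "f F \<in> X" for f X
      using that by auto
    have "restrict \<sigma> F \<in> F \<rightarrow>\<^sub>E A"
      using that assms(4) by (auto simp: configs_def)
    from *[of "restrict \<sigma>", OF this]
    have "(\<forall>(F', p)\<in>P. restrict \<sigma> F' \<noteq> p) \<longleftrightarrow> Q (restrict \<sigma> F)"
      unfolding P_def .
    then show ?thesis using that by (simp add: avoiding_def)
  qed
  have restr: "restrict (config_act G \<sigma> g) F = (\<lambda>h\<in>F. \<sigma> (g \<otimes> h))"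
    for \<sigma> :: "'a \<Rightarrow> 'c" and g
    using assms(4) by (auto simp: config_act_def restrict_def fun_eq_iff)
  have "?S = (\<Inter>g\<in>carrier G. (\<lambda>\<sigma>. config_act G \<sigma> g) ` avoiding G A P)"
  proof (intro equalityI subsetI INT_I)
    fix \<sigma> g assume \<sigma>: "\<sigma> \<in> ?S" and g: "g \<in> carrier G"
    have "config_act G \<sigma> (inv g) \<in> avoiding G A P"
      using \<sigma> g by (simp add: avoid act_mem restr)
    moreover have "config_act G (config_act G \<sigma> (inv g)) g = \<sigma>"
      using \<sigma> g by (simp add: act_inv)
    ultimately show "\<sigma> \<in> (\<lambda>\<sigma>. config_act G \<sigma> g) ` avoiding G A P"
      by (metis imageI)
  next
    fix \<sigma> assume \<sigma>: "\<sigma> \<in> (\<Inter>g\<in>carrier G. (\<lambda>\<sigma>. config_act G \<sigma> g) ` avoiding G A P)"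
    have *: "\<sigma> \<in> configs G A \<and> config_act G \<sigma> g \<in> avoiding G A P" if g: "g \<in> carrier G" for g
    proof -
      have "\<sigma> \<in> (\<lambda>\<sigma>. config_act G \<sigma> (inv g)) ` avoiding G A P"
        using \<sigma> g by blast
      then obtain \<tau> where \<tau>: "\<tau> \<in> avoiding G A P" "\<sigma> = config_act G \<tau> (inv g)"
        by blast
      then have "\<tau> \<in> configs G A" by (simp add: avoiding_def)
      then show ?thesis using \<tau> g by (simp add: act_inv act_mem)
    qed
    show "\<sigma> \<in> ?S"
      using *[OF one_closed] * avoid[OF act_mem] unfolding restr by blast
  qed
  moreover have "finite P"
  proof -
    have "finite (F \<rightarrow>\<^sub>E A)" using assms by (simp add: finite_PiE)
    then show ?thesis by (simp add: P_def)
  qed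
  moreover have "P \<subseteq> patterns G A"
    using assms by (auto simp: P_def patterns_def)
  ultimately show ?thesis unfolding SFT_def by blast
qed

lemma fixed_by_rcos_eq:
  fixes G (structure)
  assumes "group G" "subgroup \<Gamma> G" "fixed_by G \<sigma> \<Gamma>"
    and "g \<in> carrier G" "h \<in> carrier G" "\<Gamma> #> g = \<Gamma> #> h"
  shows "\<sigma> g = \<sigma> h"
proof -
  interpret group G by fact
  have "g \<in> \<Gamma> #> h"
    using rcos_self[OF assms(4,2)] assms(6) by simp
  then obtain \<gamma> where \<gamma>: "\<gamma> \<in> \<Gamma>" "g = \<gamma> \<otimes> h"
    by (auto simp: r_coset_def)
  have "config_act G \<sigma> \<gamma> h = \<sigma> h"
    using assms(3) \<gamma>(1) by (simp add: fixed_by_def)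
  then show ?thesis
    using \<gamma>(2) assms(5) by (simp add: config_act_def)
qed

text \<open>
  Right multiplication by \<open>t\<close> permutes the finitely many right cosets; the pigeonhole principle
  applies to the powers of \<open>t\<close> acting on all the cosets of \<open>S\<close> at once.
\<close>

lemma finite_index_power_stabilizes_rcosets:
  fixes G (structure)
  assumes "group G" "finite_index_subgroup \<Gamma> G"
    and "finite S" "S \<subseteq> carrier G" "t \<in> carrier G"
  obtains m :: nat where "m > 0" "\<And>g. g \<in> S \<Longrightarrow> \<Gamma> #> (g \<otimes> t [^] m) = \<Gamma> #> g"
proof -
  interpret group G by fact
  have \<Gamma>: "subgroup \<Gamma> G" "\<Gamma> \<subseteq> carrier G" "finite (rcosets \<Gamma>)"
    using assms(2) subgroup.subset by (auto simp: finite_index_subgroup_def)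
  define f where "f = (\<lambda>i::nat. \<lambda>g\<in>S. \<Gamma> #> (g \<otimes> t [^] i))"
  have "\<Gamma> #> (g \<otimes> t [^] i) \<in> rcosets \<Gamma>" if "g \<in> S" for g and i :: nat
    using that assms(4,5) by (intro rcosetsI[OF \<Gamma>(2)]) auto
  then have "range f \<subseteq> S \<rightarrow>\<^sub>E rcosets \<Gamma>"
    by (auto simp: f_def)
  then have "finite (range f)"
    using assms(3) \<Gamma>(3) by (meson finite_PiE finite_subset)
  then have "\<not> inj f"
    using finite_imageD by blast
  then obtain i j where "i < j" "f i = f j"
    by (metis injI nat_neq_iff)
  have "\<Gamma> #> (g \<otimes> t [^] (j - i)) = \<Gamma> #> g" if "g \<in> S" for g
  proof -
    have g: "g \<in> carrier G" using that assms(4) by blast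
    have "\<Gamma> #> (g \<otimes> t [^] j) = \<Gamma> #> (g \<otimes> t [^] i)"
      using \<open>f i = f j\<close> that by (metis (no_types, lifting) f_def restrict_apply')
    moreover have "t [^] j = t [^] (j - i) \<otimes> t [^] i"
      using \<open>i < j\<close> assms(5) by (simp add: nat_pow_mult)
    ultimately have "(\<Gamma> #> (g \<otimes> t [^] (j - i))) #> t [^] i = (\<Gamma> #> g) #> t [^] i"
      using g assms(5) \<Gamma>(2) by (simp add: coset_mult_assoc m_assoc)
    then have "(\<Gamma> #> (g \<otimes> t [^] (j - i))) #> t [^] i #> inv (t [^] i)
        = (\<Gamma> #> g) #> t [^] i #> inv (t [^] i)"
      by simp
    then show ?thesis
      using g assms(5) \<Gamma>(2) by (simp add: coset_mult_assoc m_assoc)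
  qed
  then show thesis
    using that[of "j - i"] \<open>i < j\<close> by simp
qed

section \<open>Lamps and the generator of the integers\<close>

lemma lamp_closed:
  assumes "group L" "l \<in> carrier L"
  shows "lamp L l i \<in> carrier (lamplighter L)"
  using assms by (auto simp: carrier_lamplighter lamp_def group.is_monoid)

lemma lamplighter_gen_closed:
  assumes "group L"
  shows "lamplighter_gen L \<in> carrier (lamplighter L)"
  using assms by (auto simp: carrier_lamplighter lamplighter_gen_def group.is_monoid)

lemma lamplighter_gen_pow:
  assumes "group L"
  shows "lamplighter_gen L [^]\<^bsub>lamplighter L\<^esub> n = ((\<lambda>_. \<one>\<^bsub>L\<^esub>), int n)"
proof -
  interpret L: group L by fact
  interpret G: group "lamplighter L" using assms by (rule group_lamplighter)
  show ?thesis
    by (induction n) (simp_all add: one_lamplighter mult_lamplighter lamplighter_gen_def)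
qed

lemma lamp_mult_gen_pow:
  assumes "group L" "l \<in> carrier L"
  shows "lamp L l i \<otimes>\<^bsub>lamplighter L\<^esub> lamplighter_gen L [^]\<^bsub>lamplighter L\<^esub> n
    = lamplighter_gen L [^]\<^bsub>lamplighter L\<^esub> n \<otimes>\<^bsub>lamplighter L\<^esub> lamp L l (i - int n)"
proof -
  interpret L: group L by fact
  show ?thesis
    using assms by (auto simp: lamplighter_gen_pow lamp_def mult_lamplighter fun_eq_iff)
qed

lemma gen_mult_lamp:
  assumes "group L" "l \<in> carrier L"
  shows "lamplighter_gen L \<otimes>\<^bsub>lamplighter L\<^esub> lamp L l i
    = lamp L l (i + 1) \<otimes>\<^bsub>lamplighter L\<^esub> lamplighter_gen L"
proof -
  interpret L: group L by fact
  show ?thesis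
    using assms by (auto simp: lamplighter_gen_def lamp_def mult_lamplighter fun_eq_iff)
qed

lemma lamp_mult_lamp_same:
  assumes "group L"
  shows "lamp L l i \<otimes>\<^bsub>lamplighter L\<^esub> lamp L m i = lamp L (l \<otimes>\<^bsub>L\<^esub> m) i"
proof -
  interpret L: group L by fact
  show ?thesis by (auto simp: lamp_def mult_lamplighter fun_eq_iff)
qed

lemma lamp_commute:
  assumes "group L" "l \<in> carrier L" "m \<in> carrier L" "i \<noteq> j"
  shows "lamp L l i \<otimes>\<^bsub>lamplighter L\<^esub> lamp L m j = lamp L m j \<otimes>\<^bsub>lamplighter L\<^esub> lamp L l i"
proof -
  interpret L: group L by fact
  show ?thesis using assms by (auto simp: lamp_def mult_lamplighter fun_eq_iff)
qed

section \<open>The colouring rule\<close>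

definition coloring :: "('a, 'b) monoid_scheme \<Rightarrow> ((int \<Rightarrow> 'a) \<times> int \<Rightarrow> nat) \<Rightarrow> bool"
  where "coloring L \<sigma> \<longleftrightarrow> \<sigma> \<in> configs (lamplighter L) {0, 1, 2} \<and>
    (\<forall>g\<in>carrier (lamplighter L).
      (\<lambda>l. \<sigma> (g \<otimes>\<^bsub>lamplighter L\<^esub> lamp L l 0)) ` carrier L
        = {0, 1, 2} - {\<sigma> (g \<otimes>\<^bsub>lamplighter L\<^esub> lamplighter_gen L)})"

lemma SFT_coloring:
  assumes "group L" "finite (carrier L)"
  shows "SFT (lamplighter L) {0, 1, 2} {\<sigma>. coloring L \<sigma>}"
proof -
  let ?t = "lamplighter_gen L"
  let ?F = "insert ?t ((\<lambda>l. lamp L l 0) ` carrier L)"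
  let ?Q = "\<lambda>p. (\<lambda>l. p (lamp L l 0)) ` carrier L = {0, 1, 2 :: nat} - {p ?t}"
  have "SFT (lamplighter L) {0, 1, 2}
    {\<sigma> \<in> configs (lamplighter L) {0, 1, 2}. \<forall>g\<in>carrier (lamplighter L).
      ?Q (\<lambda>h\<in>?F. \<sigma> (g \<otimes>\<^bsub>lamplighter L\<^esub> h))}"
    using assms lamp_closed lamplighter_gen_closed
    by (intro SFT_local_rule group_lamplighter) auto
  then show ?thesis by (simp add: coloring_def cong: image_cong_simp)
qed

text \<open>
  The set of colours on \<open>g \<Lambda>\<^sub>0\<close> omits exactly the colour of \<open>g t\<close>, and so determines it.
\<close>

lemma coloring_parent_eqI:
  assumes "group L" "coloring L \<sigma>"
    and "g \<in> carrier (lamplighter L)" "h \<in> carrier (lamplighter L)"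
    and "(\<lambda>l. \<sigma> (g \<otimes>\<^bsub>lamplighter L\<^esub> lamp L l 0)) ` carrier L
       = (\<lambda>l. \<sigma> (h \<otimes>\<^bsub>lamplighter L\<^esub> lamp L l 0)) ` carrier L"
  shows "\<sigma> (g \<otimes>\<^bsub>lamplighter L\<^esub> lamplighter_gen L) = \<sigma> (h \<otimes>\<^bsub>lamplighter L\<^esub> lamplighter_gen L)"
    (is "?a = ?b")
proof -
  interpret G: group "lamplighter L" using assms(1) by (rule group_lamplighter)
  have "?a \<in> {0, 1, 2}" "?b \<in> {0, 1, 2}"
    using assms lamplighter_gen_closed[OF assms(1)] unfolding coloring_def configs_def
    by (meson G.m_closed PiE_mem)+
  moreover have "{0, 1, 2} - {?a} = {0, 1, 2} - {?b}"
    using assms unfolding coloring_def by metis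
  ultimately show ?thesis by blast
qed

text \<open>
  Write \<open>h = g t\<close>. Changing lamp \<open>- n - 1\<close> of \<open>h\<close> changes lamp \<open>- n\<close> of \<open>g\<close>. For \<open>n = 0\<close> this
  permutes \<open>g \<Lambda>\<^sub>0\<close>; for \<open>n > 0\<close> it commutes with \<open>\<Lambda>\<^sub>0\<close> and keeps the colours on \<open>g \<Lambda>\<^sub>0\<close> by
  induction. Either way the colours on \<open>g \<Lambda>\<^sub>0\<close> form the same set as before.
\<close>

lemma coloring_lamp_invariant:
  assumes L: "group L" and \<sigma>: "coloring L \<sigma>" and l: "l \<in> carrier L"
    and "h \<in> carrier (lamplighter L)"
  shows "\<sigma> (h \<otimes>\<^bsub>lamplighter L\<^esub> lamp L l (- int n - 1)) = \<sigma> h"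
  using \<open>h \<in> carrier (lamplighter L)\<close>
proof (induction n arbitrary: h)
  interpret L: group L by fact
  interpret G: group "lamplighter L" using L by (rule group_lamplighter)
  let ?G = "lamplighter L" and ?t = "lamplighter_gen L"
  let ?C = "\<lambda>g. (\<lambda>m. \<sigma> (g \<otimes>\<^bsub>?G\<^esub> lamp L m 0)) ` carrier L"
  note closed = lamp_closed[OF L] lamplighter_gen_closed[OF L]
  have step: "\<sigma> (h \<otimes>\<^bsub>?G\<^esub> lamp L l (i - 1)) = \<sigma> h"
    if h: "h \<in> carrier ?G"
      and C: "\<And>g. g \<in> carrier ?G \<Longrightarrow> ?C (g \<otimes>\<^bsub>?G\<^esub> lamp L l i) = ?C g" for h i
  proof -
    define g where "g = h \<otimes>\<^bsub>?G\<^esub> inv\<^bsub>?G\<^esub> ?t"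
    have g: "g \<in> carrier ?G" "h = g \<otimes>\<^bsub>?G\<^esub> ?t"
      using h closed by (simp_all add: g_def G.m_assoc)
    have "h \<otimes>\<^bsub>?G\<^esub> lamp L l (i - 1) = g \<otimes>\<^bsub>?G\<^esub> lamp L l i \<otimes>\<^bsub>?G\<^esub> ?t"
      using g closed l gen_mult_lamp[OF L l, of "i - 1"] by (simp add: G.m_assoc)
    moreover have "\<sigma> (g \<otimes>\<^bsub>?G\<^esub> lamp L l i \<otimes>\<^bsub>?G\<^esub> ?t) = \<sigma> (g \<otimes>\<^bsub>?G\<^esub> ?t)"
      using C[OF g(1)] g(1) closed l by (intro coloring_parent_eqI[OF L \<sigma>]) auto
    ultimately show ?thesis using g(2) by simp
  qed
  {
    case 0
    have "?C (g \<otimes>\<^bsub>?G\<^esub> lamp L l 0) = ?C g" if g: "g \<in> carrier ?G" for g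
    proof -
      have "?C (g \<otimes>\<^bsub>?G\<^esub> lamp L l 0) = (\<lambda>m. \<sigma> (g \<otimes>\<^bsub>?G\<^esub> lamp L m 0)) ` (\<lambda>m. l \<otimes>\<^bsub>L\<^esub> m) ` carrier L"
        unfolding image_image
        using g closed l by (intro image_cong) (simp_all add: G.m_assoc lamp_mult_lamp_same[OF L])
      then show ?thesis by (simp add: L.surj_const_mult l)
    qed
    with step[OF 0, of 0] show ?case by simp
  next
    case (Suc n)
    have "?C (g \<otimes>\<^bsub>?G\<^esub> lamp L l (- int n - 1)) = ?C g" if g: "g \<in> carrier ?G" for g
    proof (intro image_cong refl)
      fix m assume m: "m \<in> carrier L"
      have "g \<otimes>\<^bsub>?G\<^esub> lamp L l (- int n - 1) \<otimes>\<^bsub>?G\<^esub> lamp L m 0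
          = g \<otimes>\<^bsub>?G\<^esub> lamp L m 0 \<otimes>\<^bsub>?G\<^esub> lamp L l (- int n - 1)"
        using g closed l m lamp_commute[OF L l m, of "- int n - 1" 0] by (simp add: G.m_assoc)
      then show "\<sigma> (g \<otimes>\<^bsub>?G\<^esub> lamp L l (- int n - 1) \<otimes>\<^bsub>?G\<^esub> lamp L m 0) = \<sigma> (g \<otimes>\<^bsub>?G\<^esub> lamp L m 0)"
        using Suc.IH g closed m by simp
    qed
    with step[OF Suc.prems, of "- int n - 1"] show ?case by (simp add: algebra_simps)
  }
qed

text \<open>
  With respect to a subgroup of finite index, lamp 0 cannot be told from lamp \<open>- m\<close> for a suitable
  \<open>m > 0\<close>; but a colour never depends on the latter and must depend on the former.
\<close>

lemma coloring_not_fixed_by_finite_index: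
  assumes L: "group L" "finite (carrier L)" and \<sigma>: "coloring L \<sigma>"
    and \<Gamma>: "finite_index_subgroup \<Gamma> (lamplighter L)"
  shows "\<not> fixed_by (lamplighter L) \<sigma> \<Gamma>"
proof
  let ?G = "lamplighter L" and ?t = "lamplighter_gen L"
  interpret L: group L by fact
  interpret G: group ?G using L(1) by (rule group_lamplighter)
  assume fixed: "fixed_by ?G \<sigma> \<Gamma>"
  have sub: "subgroup \<Gamma> ?G" using \<Gamma> by (simp add: finite_index_subgroup_def)
  note closed = lamp_closed[OF L(1)] lamplighter_gen_closed[OF L(1)]
  have "finite ((\<lambda>l. lamp L l 0) ` carrier L)" "(\<lambda>l. lamp L l 0) ` carrier L \<subseteq> carrier ?G"
    using L(2) closed by auto
  then obtain m :: nat where m: "m > 0" "\<And>g. g \<in> (\<lambda>l. lamp L l 0) ` carrier L \<Longrightarrow>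
      \<Gamma> #>\<^bsub>?G\<^esub> (g \<otimes>\<^bsub>?G\<^esub> ?t [^]\<^bsub>?G\<^esub> m) = \<Gamma> #>\<^bsub>?G\<^esub> g"
    by (rule finite_index_power_stabilizes_rcosets[OF G.is_group \<Gamma> _ _ closed(2)]) blast
  have const: "\<sigma> (lamp L l 0) = \<sigma> (?t [^]\<^bsub>?G\<^esub> m)" if l: "l \<in> carrier L" for l
  proof -
    have "\<sigma> (lamp L l 0) = \<sigma> (lamp L l 0 \<otimes>\<^bsub>?G\<^esub> ?t [^]\<^bsub>?G\<^esub> m)"
      using m(2)[of "lamp L l 0"] l closed
      by (intro fixed_by_rcos_eq[OF G.is_group sub fixed]) simp_all
    (* the position - m is negative because m > 0, as the invariance of colours requires *)
    also have "\<dots> = \<sigma> (?t [^]\<^bsub>?G\<^esub> m \<otimes>\<^bsub>?G\<^esub> lamp L l (- int (m - 1) - 1))"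
      using lamp_mult_gen_pow[OF L(1) l, of 0 m] m(1) by (simp add: of_nat_diff)
    also have "\<dots> = \<sigma> (?t [^]\<^bsub>?G\<^esub> m)"
      using closed by (intro coloring_lamp_invariant[OF L(1) \<sigma> l]) simp
    finally show ?thesis .
  qed
  have "{0, 1, 2} - {\<sigma> (\<one>\<^bsub>?G\<^esub> \<otimes>\<^bsub>?G\<^esub> ?t)}
      = (\<lambda>l. \<sigma> (\<one>\<^bsub>?G\<^esub> \<otimes>\<^bsub>?G\<^esub> lamp L l 0)) ` carrier L"
    using \<sigma> G.one_closed unfolding coloring_def by metis
  also have "\<dots> \<subseteq> {\<sigma> (?t [^]\<^bsub>?G\<^esub> m)}"
    using const closed by (intro image_subsetI) simp
  finally have "{0, 1, 2} \<subseteq> {\<sigma> (\<one>\<^bsub>?G\<^esub> \<otimes>\<^bsub>?G\<^esub> ?t), \<sigma> (?t [^]\<^bsub>?G\<^esub> m)}"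
    by (simp only: Diff_subset_conv insert_is_Un[symmetric])
  then have "card {0, 1, 2 :: nat} \<le> card {\<sigma> (\<one>\<^bsub>?G\<^esub> \<otimes>\<^bsub>?G\<^esub> ?t), \<sigma> (?t [^]\<^bsub>?G\<^esub> m)}"
    by (intro card_mono) auto
  also have "\<dots> \<le> 2"
    by (simp add: card_insert_if)
  finally show False by simp
qed

section \<open>A colouring\<close>

text \<open>
  Going down one level from a parent adds 1 modulo 3 to the colour, and one more if the lamp
  that is passed is on. Far above the support of \<open>x\<close> all lamps are off, which leaves only \<open>- k\<close>.
\<close>

definition height_lamp_count :: "('a, 'b) monoid_scheme \<Rightarrow> (int \<Rightarrow> 'a) \<times> int \<Rightarrow> nat"
  where "height_lamp_count L =
    (\<lambda>(x, k). nat ((int (card {j. k \<le> j \<and> x j \<noteq> \<one>\<^bsub>L\<^esub>}) - k) mod 3))"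

lemma nat_mod_3_pair:
  "{nat (z mod 3), nat ((z + 1) mod 3)} = {0, 1, 2} - {nat ((z - 1) mod 3)}"
proof -
  consider "z mod 3 = 0" | "z mod 3 = 1" | "z mod 3 = 2" by linarith
  then show ?thesis
  proof cases
    case 1
    then have "(z + 1) mod 3 = 1" "(z - 1) mod 3 = 2" by presburger+
    then show ?thesis using 1 by auto
  next
    case 2
    then have "(z + 1) mod 3 = 2" "(z - 1) mod 3 = 0" by presburger+
    then show ?thesis using 2 by auto
  next
    case 3
    then have "(z + 1) mod 3 = 0" "(z - 1) mod 3 = 1" by presburger+
    then show ?thesis using 3 by auto
  qed
qed

lemma coloring_height_lamp_count:
  assumes L: "group L" and card: "card (carrier L) \<ge> 2"
  shows "coloring L (restrict (height_lamp_count L) (carrier (lamplighter L)))"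
proof -
  let ?G = "lamplighter L" and ?t = "lamplighter_gen L"
  interpret L: group L by fact
  interpret G: group ?G using L by (rule group_lamplighter)
  have "z mod 3 = 0 \<or> z mod 3 = 1 \<or> z mod 3 = 2" for z :: int by presburger
  then have "nat (z mod 3) \<in> {0, 1, 2}" for z :: int
    by (smt (verit) insertCI nat_0 nat_one_as_int nat_2 numeral_2_eq_2)
  then have "height_lamp_count L g \<in> {0, 1, 2}" for g
    by (simp only: height_lamp_count_def split_def)
  then have range: "restrict (height_lamp_count L) (carrier ?G) \<in> configs ?G {0, 1, 2}"
    unfolding configs_def by (simp only: restrict_PiE_iff) blast
  obtain u where u: "u \<in> carrier L" "u \<noteq> \<one>\<^bsub>L\<^esub>"
    using card card_mono[of "{\<one>\<^bsub>L\<^esub>}" "carrier L"] by fastforce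
  have rule: "(\<lambda>l. height_lamp_count L (g \<otimes>\<^bsub>?G\<^esub> lamp L l 0)) ` carrier L
      = {0, 1, 2} - {height_lamp_count L (g \<otimes>\<^bsub>?G\<^esub> ?t)}" if "g \<in> carrier ?G" for g
  proof -
    obtain x k where g: "g = (x, k)" by (cases g)
    then have x: "x i \<in> carrier L" and fin: "finite {i. x i \<noteq> \<one>\<^bsub>L\<^esub>}" for i
      using that by (simp_all add: carrier_lamplighter[OF L])
    define above where "above = {j. k + 1 \<le> j \<and> x j \<noteq> \<one>\<^bsub>L\<^esub>}"
    define z where "z = int (card above) - k"
    have above: "finite above" "k \<notin> above"
      using fin by (auto simp: above_def)
    have parent: "height_lamp_count L (g \<otimes>\<^bsub>?G\<^esub> ?t) = nat ((z - 1) mod 3)"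
      by (simp add: g x mult_lamplighter lamplighter_gen_def height_lamp_count_def z_def above_def
          algebra_simps)
    have child: "height_lamp_count L (g \<otimes>\<^bsub>?G\<^esub> lamp L l 0)
        = nat ((if x k \<otimes>\<^bsub>L\<^esub> l = \<one>\<^bsub>L\<^esub> then z else z + 1) mod 3)" if "l \<in> carrier L" for l
    proof -
      have "g \<otimes>\<^bsub>?G\<^esub> lamp L l 0 = (x(k := x k \<otimes>\<^bsub>L\<^esub> l), k)"
        using x by (auto simp: g mult_lamplighter lamp_def fun_eq_iff)
      moreover have "{j. k \<le> j \<and> (x(k := x k \<otimes>\<^bsub>L\<^esub> l)) j \<noteq> \<one>\<^bsub>L\<^esub>}
          = (if x k \<otimes>\<^bsub>L\<^esub> l = \<one>\<^bsub>L\<^esub> then above else insert k above)"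
        by (auto simp: above_def)
      ultimately show ?thesis
        using above by (simp add: height_lamp_count_def z_def algebra_simps)
    qed
    have "(\<lambda>l. height_lamp_count L (g \<otimes>\<^bsub>?G\<^esub> lamp L l 0)) ` carrier L
        = (\<lambda>y. nat ((if y = \<one>\<^bsub>L\<^esub> then z else z + 1) mod 3)) ` (\<lambda>l. x k \<otimes>\<^bsub>L\<^esub> l) ` carrier L"
      unfolding image_image using child by (intro image_cong) auto
    (* the child colours depend only on the new state of lamp k, which can be any element of L *)
    also have "\<dots> = (\<lambda>y. nat ((if y = \<one>\<^bsub>L\<^esub> then z else z + 1) mod 3)) ` carrier L"
      by (simp add: L.surj_const_mult x)
    also have "\<dots> = {nat (z mod 3), nat ((z + 1) mod 3)}" (is "?f ` _ = _")
    proof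
      show "{nat (z mod 3), nat ((z + 1) mod 3)} \<subseteq> ?f ` carrier L"
        using imageI[OF L.one_closed, of ?f] imageI[OF u(1), of ?f] u(2) by simp
    qed auto
    finally show ?thesis by (simp only: parent nat_mod_3_pair)
  qed
  show ?thesis
    unfolding coloring_def
    using range rule lamp_closed[OF L] lamplighter_gen_closed[OF L]
    by (simp cong: image_cong_simp)
qed

theorem theorem1p1:
  fixes L :: "('a, 'b) monoid_scheme"
  assumes "group L" and "finite (carrier L)" and "card (carrier L) \<ge> 2"
  shows "\<exists>(A :: nat set) S. finite A \<and> SFT (lamplighter L) A S \<and> weakly_aperiodic (lamplighter L) S"
proof (intro exI conjI)
  show "SFT (lamplighter L) {0, 1, 2} {\<sigma>. coloring L \<sigma>}"
    using assms by (intro SFT_coloring)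
  show "weakly_aperiodic (lamplighter L) {\<sigma>. coloring L \<sigma>}"
    using coloring_height_lamp_count[OF assms(1,3)] coloring_not_fixed_by_finite_index[OF assms(1,2)]
    unfolding weakly_aperiodic_def by blast
qed simp

end
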